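(* Let $\mathfrak g$ be a real Lie algebra with a complex product structure $\{J,E\}$, let $\hat{\mathfrak g}=(\mathfrak g^{\mathbb C})_{\mathbb R}$ carry the induced hypercomplex structure, and let $G$ and $\hat G$ be the simply connected Lie groups with Lie algebras $\mathfrak g$ and $\hat{\mathfrak g}$, respectively. Then the holonomy algebra $\mathfrak{hol}^{\mathrm{Ob}}$ of the Obata connection of $\hat G$ is the complexification of the holonomy algebra $\mathfrak{hol}^{\mathrm{CP}}$ of the connection $\nabla^{\mathrm{CP}}$ on $G$; more precisely, $\mathfrak{hol}^{\mathrm{Ob}}=((\mathfrak{hol}^{\mathrm{CP}})^{\mathbb C})_{\mathbb R}$.
   Context: All Lie algebras are finite dimensional. A complex product structure $\{J,E\}$ on $\mathfrak g$ consists of an integrable $J$ ($J^2=-\mathrm{Id}$, $[x,y]+J([Jx,y]+[x,Jy])-[Jx,Jy]=0$) and $E$ with $E^2=\mathrm{Id}$, $JE=-EJ$, whose $(\pm1)$-eigenspaces $\mathfrak g_\pm$ are Lie subalgebras; then $\mathfrak g=\mathfrak g_+\oplus\mathfrak g_-$ and $J\mathfrak g_+=\mathfrak g_-$. There is a unique torsion-free connection $\nabla^{\mathrm{CP}}$ on $\mathfrak g$ (i.e. left-invariant on $G$) with $\nabla^{\mathrm{CP}}J=\nabla^{\mathrm{CP}}E=0$. $(\cdot)_{\mathbb R}$ means "viewed as a real Lie algebra". The induced hypercomplex structure on $\hat{\mathfrak g}$ is $J_1(x+iy)=Jx+iJy$; $J_2(x+iy)=i(x+iy)$ for $x,y\in\mathfrak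 g_+$, $J_2(x+iy)=-i(x+iy)$ for $x,y\in\mathfrak g_-$; $J_3=J_1J_2$. The Obata connection is the unique torsion-free connection on $\hat{\mathfrak g}$ (left-invariant on $\hat G$) with $J_1,J_2,J_3$ parallel. The holonomy algebra of a left-invariant connection $\nabla$ on a Lie group with Lie algebra $\mathfrak h$, at the identity, is the smallest Lie subalgebra of $\operatorname{End}(\mathfrak h)$ containing the curvature endomorphisms $R(x,y)$ and closed under commutators with all $\nabla_u$. The complexification $(\mathfrak{hol}^{\mathrm{CP}})^{\mathbb C}$ is regarded in $\operatorname{End}_{\mathbb C}(\mathfrak g^{\mathbb C})\subset\operatorname{End}_{\mathbb R}(\hat{\mathfrak g})$. *)

theory Defs
  imports "HOL-Analysis.Analysis"
begin

section \<open>Lie algebras and left-invariant connections\<close>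

definition lie_algebra :: "('a::real_vector \<Rightarrow> 'a \<Rightarrow> 'a) \<Rightarrow> bool" where
  "lie_algebra br \<longleftrightarrow>
     (\<exists>B::'a set. finite B \<and> span B = UNIV) \<and>
     bilinear br \<and>
     (\<forall>x. br x x = 0) \<and>
     (\<forall>x y z. br x (br y z) + br y (br z x) + br z (br x y) = 0)"

definition lie_subalgebra :: "('a::real_vector \<Rightarrow> 'a \<Rightarrow> 'a) \<Rightarrow> 'a set \<Rightarrow> bool" where
  "lie_subalgebra br S \<longleftrightarrow> subspace S \<and> (\<forall>x\<in>S. \<forall>y\<in>S. br x y \<in> S)"

text \<open>
  A left-invariant affine connection on a Lie group is determined by its values on left-invariant
  vector fields, that is, by a bilinear map on the Lie algebra of the group; conversely every such
  bilinear map arises from exactly one left-invariant connection.  We write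
  \<open>nab x y\<close> for \<open>\<nabla>\<^sub>x y\<close>.
\<close>

definition left_invariant_connection :: "('a::real_vector \<Rightarrow> 'a \<Rightarrow> 'a) \<Rightarrow> bool" where
  "left_invariant_connection nab \<longleftrightarrow> bilinear nab"

definition torsion_free :: "('a::real_vector \<Rightarrow> 'a \<Rightarrow> 'a) \<Rightarrow> ('a \<Rightarrow> 'a \<Rightarrow> 'a) \<Rightarrow> bool" where
  "torsion_free br nab \<longleftrightarrow> (\<forall>x y. nab x y - nab y x - br x y = 0)"

definition parallel :: "('a::real_vector \<Rightarrow> 'a \<Rightarrow> 'a) \<Rightarrow> ('a \<Rightarrow> 'a) \<Rightarrow> bool" where
  "parallel nab T \<longleftrightarrow> (\<forall>x y. nab x (T y) - T (nab x y) = 0)"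

definition curvature ::
  "('a::real_vector \<Rightarrow> 'a \<Rightarrow> 'a) \<Rightarrow> ('a \<Rightarrow> 'a \<Rightarrow> 'a) \<Rightarrow> 'a \<Rightarrow> 'a \<Rightarrow> 'a \<Rightarrow> 'a" where
  "curvature br nab x y = (\<lambda>z. nab x (nab y z) - nab y (nab x z) - nab (br x y) z)"


section \<open>The holonomy algebra\<close>

definition End_commutator :: "('a::real_vector \<Rightarrow> 'a) \<Rightarrow> ('a \<Rightarrow> 'a) \<Rightarrow> 'a \<Rightarrow> 'a" where
  "End_commutator A B = (\<lambda>x. A (B x) - B (A x))"

text \<open>
  Real Lie subalgebras of \<open>End\<close>.  The function type is not an instance of
  \<^class>\<open>real_vector\<close>, so the vector space operations are written pointwise.
\<close>

definition lie_subalgebra_End :: "('a::real_vector \<Rightarrow> 'a) set \<Rightarrow> bool" where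
  "lie_subalgebra_End S \<longleftrightarrow>
     (\<forall>A\<in>S. linear A) \<and>
     (\<lambda>x. 0) \<in> S \<and>
     (\<forall>A\<in>S. \<forall>B\<in>S. (\<lambda>x. A x + B x) \<in> S) \<and>
     (\<forall>c. \<forall>A\<in>S. (\<lambda>x. c *\<^sub>R A x) \<in> S) \<and>
     (\<forall>A\<in>S. \<forall>B\<in>S. End_commutator A B \<in> S)"

text \<open>
  The holonomy algebra at the identity of the left-invariant connection \<open>nab\<close> on a Lie group with
  Lie algebra \<open>('a, br)\<close>, expressed on the Lie algebra: the smallest Lie subalgebra of \<open>End\<close> that
  contains the curvature endomorphisms and is closed under commutators with all \<open>nab u\<close>.
\<close>

definition holonomy_algebra ::
  "('a::real_vector \<Rightarrow> 'a \<Rightarrow> 'a) \<Rightarrow> ('a \<Rightarrow> 'a \<Rightarrow> 'a) \<Rightarrow> ('a \<Rightarrow> 'a) set" where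
  "holonomy_algebra br nab =
     \<Inter> {S. lie_subalgebra_End S \<and>
            (\<forall>x y. curvature br nab x y \<in> S) \<and>
            (\<forall>u. \<forall>A\<in>S. End_commutator (nab u) A \<in> S)}"


section \<open>Complex product structures\<close>

definition integrable_structure :: "('a::real_vector \<Rightarrow> 'a \<Rightarrow> 'a) \<Rightarrow> ('a \<Rightarrow> 'a) \<Rightarrow> bool" where
  "integrable_structure br J \<longleftrightarrow>
     (\<forall>x y. br x y + J (br (J x) y + br x (J y)) - br (J x) (J y) = 0)"

definition complex_structure :: "('a::real_vector \<Rightarrow> 'a \<Rightarrow> 'a) \<Rightarrow> ('a \<Rightarrow> 'a) \<Rightarrow> bool" where
  "complex_structure br J \<longleftrightarrow> linear J \<and> (\<forall>x. J (J x) = - x) \<and> integrable_structure br J"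

definition eigenspace_plus :: "('a::real_vector \<Rightarrow> 'a) \<Rightarrow> 'a set" where
  "eigenspace_plus E = {x. E x = x}"

definition eigenspace_minus :: "('a::real_vector \<Rightarrow> 'a) \<Rightarrow> 'a set" where
  "eigenspace_minus E = {x. E x = - x}"

definition complex_product_structure ::
  "('a::real_vector \<Rightarrow> 'a \<Rightarrow> 'a) \<Rightarrow> ('a \<Rightarrow> 'a) \<Rightarrow> ('a \<Rightarrow> 'a) \<Rightarrow> bool" where
  "complex_product_structure br J E \<longleftrightarrow>
     complex_structure br J \<and>
     linear E \<and> (\<forall>x. E (E x) = x) \<and>
     (\<forall>x. J (E x) = - E (J x)) \<and>
     lie_subalgebra br (eigenspace_plus E) \<and>
     lie_subalgebra br (eigenspace_minus E)"

definition is_cp_connection ::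
  "('a::real_vector \<Rightarrow> 'a \<Rightarrow> 'a) \<Rightarrow> ('a \<Rightarrow> 'a) \<Rightarrow> ('a \<Rightarrow> 'a) \<Rightarrow> ('a \<Rightarrow> 'a \<Rightarrow> 'a) \<Rightarrow> bool" where
  "is_cp_connection br J E nab \<longleftrightarrow>
     left_invariant_connection nab \<and> torsion_free br nab \<and> parallel nab J \<and> parallel nab E"

definition cp_connection ::
  "('a::real_vector \<Rightarrow> 'a \<Rightarrow> 'a) \<Rightarrow> ('a \<Rightarrow> 'a) \<Rightarrow> ('a \<Rightarrow> 'a) \<Rightarrow> 'a \<Rightarrow> 'a \<Rightarrow> 'a" where
  "cp_connection br J E = (THE nab. is_cp_connection br J E nab)"


section \<open>Hypercomplex structures and the Obata connection\<close>

definition hypercomplex_structure ::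
  "('a::real_vector \<Rightarrow> 'a \<Rightarrow> 'a) \<Rightarrow> ('a \<Rightarrow> 'a) \<Rightarrow> ('a \<Rightarrow> 'a) \<Rightarrow> ('a \<Rightarrow> 'a) \<Rightarrow> bool" where
  "hypercomplex_structure br J1 J2 J3 \<longleftrightarrow>
     complex_structure br J1 \<and> complex_structure br J2 \<and> complex_structure br J3 \<and>
     (\<forall>x. J3 x = J1 (J2 x)) \<and> (\<forall>x. J1 (J2 x) = - J2 (J1 x))"

definition is_obata_connection ::
  "('a::real_vector \<Rightarrow> 'a \<Rightarrow> 'a) \<Rightarrow> ('a \<Rightarrow> 'a) \<Rightarrow> ('a \<Rightarrow> 'a) \<Rightarrow> ('a \<Rightarrow> 'a) \<Rightarrow>
   ('a \<Rightarrow> 'a \<Rightarrow> 'a) \<Rightarrow> bool" where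
  "is_obata_connection br J1 J2 J3 nab \<longleftrightarrow>
     left_invariant_connection nab \<and> torsion_free br nab \<and>
     parallel nab J1 \<and> parallel nab J2 \<and> parallel nab J3"

definition obata_connection ::
  "('a::real_vector \<Rightarrow> 'a \<Rightarrow> 'a) \<Rightarrow> ('a \<Rightarrow> 'a) \<Rightarrow> ('a \<Rightarrow> 'a) \<Rightarrow> ('a \<Rightarrow> 'a) \<Rightarrow>
   'a \<Rightarrow> 'a \<Rightarrow> 'a" where
  "obata_connection br J1 J2 J3 = (THE nab. is_obata_connection br J1 J2 J3 nab)"


section \<open>Complexification\<close>

text \<open>
  The complexification of a real vector space of type \<open>'a\<close>, viewed as a real vector space, is
  \<open>'a \<times> 'a\<close>; the pair \<open>(x, y)\<close> stands for \<open>x + i y\<close>.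
\<close>

definition mult_i :: "'a::real_vector \<times> 'a \<Rightarrow> 'a \<times> 'a" where
  "mult_i z = (- snd z, fst z)"

definition hat_bracket ::
  "('a::real_vector \<Rightarrow> 'a \<Rightarrow> 'a) \<Rightarrow> 'a \<times> 'a \<Rightarrow> 'a \<times> 'a \<Rightarrow> 'a \<times> 'a" where
  "hat_bracket br z w =
     (br (fst z) (fst w) - br (snd z) (snd w), br (fst z) (snd w) + br (snd z) (fst w))"

definition cmplx_map :: "('a::real_vector \<Rightarrow> 'a) \<Rightarrow> 'a \<times> 'a \<Rightarrow> 'a \<times> 'a" where
  "cmplx_map A z = (A (fst z), A (snd z))"

text \<open>
  The complexification of a real subspace \<open>H\<close> of \<open>End(V)\<close> inside the complex-linear endomorphisms
  of the complexification of \<open>V\<close>: all \<open>A + i B\<close> with \<open>A\<close>, \<open>B\<close> in \<open>H\<close>.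
\<close>

definition complexification_End :: "('a::real_vector \<Rightarrow> 'a) set \<Rightarrow> ('a \<times> 'a \<Rightarrow> 'a \<times> 'a) set" where
  "complexification_End H =
     {C. \<exists>A\<in>H. \<exists>B\<in>H. C = (\<lambda>z. cmplx_map A z + mult_i (cmplx_map B z))}"


section \<open>The induced hypercomplex structure on the complexification\<close>

definition proj_plus :: "('a::real_vector \<Rightarrow> 'a) \<Rightarrow> 'a \<Rightarrow> 'a" where
  "proj_plus E x = (1/2) *\<^sub>R (x + E x)"

definition proj_minus :: "('a::real_vector \<Rightarrow> 'a) \<Rightarrow> 'a \<Rightarrow> 'a" where
  "proj_minus E x = (1/2) *\<^sub>R (x - E x)"

definition hat_J1 :: "('a::real_vector \<Rightarrow> 'a) \<Rightarrow> 'a \<times> 'a \<Rightarrow> 'a \<times> 'a" where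
  "hat_J1 J = (\<lambda>(x, y). (J x, J y))"

text \<open>
  Multiplication by \<open>i\<close> on the complexified \<open>+1\<close>-eigenspace of \<open>E\<close> and by \<open>-i\<close> on the complexified
  \<open>-1\<close>-eigenspace, extended additively along the splitting; see \<open>hat_J2_eigenspaces\<close> and
  \<open>hat_J2_unique\<close> below.
\<close>

definition hat_J2 :: "('a::real_vector \<Rightarrow> 'a) \<Rightarrow> 'a \<times> 'a \<Rightarrow> 'a \<times> 'a" where
  "hat_J2 E z = mult_i (cmplx_map (proj_plus E) z) - mult_i (cmplx_map (proj_minus E) z)"

definition hat_J3 :: "('a::real_vector \<Rightarrow> 'a) \<Rightarrow> ('a \<Rightarrow> 'a) \<Rightarrow> 'a \<times> 'a \<Rightarrow> 'a \<times> 'a" where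
  "hat_J3 J E = hat_J1 J \<circ> hat_J2 E"

lemma half_half: "(1/2::real) *\<^sub>R (x + x) = (x::'a::real_vector)"
  by (simp flip: scaleR_2)

lemma proj_plus_add_proj_minus: "proj_plus E x + proj_minus E x = x"
  by (simp add: proj_plus_def proj_minus_def half_half flip: scaleR_add_right)

lemma proj_plus_diff_proj_minus: "proj_plus E x - proj_minus E x = E x"
  by (simp add: proj_plus_def proj_minus_def half_half flip: scaleR_diff_right)

lemma proj_mem:
  assumes "linear E" "\<And>x. E (E x) = x"
  shows "E (proj_plus E x) = proj_plus E x" "E (proj_minus E x) = - proj_minus E x"
  using assms
  by (simp_all add: proj_plus_def proj_minus_def linear_scale linear_add linear_diff add.commute
      flip: scaleR_minus_right)

lemma hat_J2_eq: "hat_J2 E (x, y) = (- E y, E x)"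
proof -
  have "hat_J2 E (x, y) =
      (- (proj_plus E y - proj_minus E y), proj_plus E x - proj_minus E x)"
    by (simp add: hat_J2_def mult_i_def cmplx_map_def)
  then show ?thesis by (simp add: proj_plus_diff_proj_minus)
qed

lemma hat_J2_eigenspaces:
  "x \<in> eigenspace_plus E \<Longrightarrow> y \<in> eigenspace_plus E \<Longrightarrow> hat_J2 E (x, y) = mult_i (x, y)"
  "x \<in> eigenspace_minus E \<Longrightarrow> y \<in> eigenspace_minus E \<Longrightarrow> hat_J2 E (x, y) = - mult_i (x, y)"
  by (simp_all add: eigenspace_plus_def eigenspace_minus_def hat_J2_eq mult_i_def)

lemma hat_J2_unique:
  assumes E: "linear E" "\<And>x. E (E x) = x" and K: "linear K"
    and plus: "\<And>x y. x \<in> eigenspace_plus E \<Longrightarrow> y \<in> eigenspace_plus E \<Longrightarrow>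
                  K (x, y) = mult_i (x, y)"
    and minus: "\<And>x y. x \<in> eigenspace_minus E \<Longrightarrow> y \<in> eigenspace_minus E \<Longrightarrow>
                  K (x, y) = - mult_i (x, y)"
  shows "K = hat_J2 E"
proof
  fix z :: "'a \<times> 'a"
  obtain x y where z: "z = (x, y)" by fastforce
  have split: "(x, y) = (proj_plus E x, proj_plus E y) + (proj_minus E x, proj_minus E y)"
    by (simp add: proj_plus_add_proj_minus)
  have "K (x, y) = K (proj_plus E x, proj_plus E y) + K (proj_minus E x, proj_minus E y)"
    by (subst split) (rule linear_add[OF K])
  also have "\<dots> = hat_J2 E (x, y)"
    using proj_mem[OF E]
    by (simp add: plus minus eigenspace_plus_def eigenspace_minus_def hat_J2_def cmplx_map_def)
  finally show "K z = hat_J2 E z" by (simp add: z)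
qed


section \<open>The notions above are well defined\<close>

lemma bilinear_hat:
  assumes "bilinear b"
  shows "bilinear (hat_bracket b)"
proof -
  have l: "linear (b x)" "linear (\<lambda>x. b x y)" for x y
    using assms by (auto simp: bilinear_def)
  show ?thesis
    unfolding bilinear_def
    by (auto intro!: linearI simp: hat_bracket_def linear_add[OF l(1)] linear_add[OF l(2)]
        linear_scale[OF l(1)] linear_scale[OF l(2)] algebra_simps)
qed

lemma lie_algebra_antisym:
  assumes "lie_algebra br"
  shows "br x y = - br y x"
proof -
  have b: "bilinear br" and a: "\<And>x. br x x = 0" using assms by (auto simp: lie_algebra_def)
  have "br (x + y) (x + y) = br x x + br x y + (br y x + br y y)"
    by (simp add: bilinear_ladd[OF b] bilinear_radd[OF b])
  then show ?thesis by (simp add: a eq_neg_iff_add_eq_0)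
qed

lemma lie_algebra_hat:
  fixes br :: "'a::real_vector \<Rightarrow> 'a \<Rightarrow> 'a"
  assumes "lie_algebra br"
  shows "lie_algebra (hat_bracket br)"
proof -
  have b: "bilinear br"
    and jac: "\<And>x y z. br x (br y z) + br y (br z x) + br z (br x y) = 0"
    using assms by (auto simp: lie_algebra_def)
  obtain B :: "'a set" where B: "finite B" "span B = UNIV"
    using assms by (auto simp: lie_algebra_def)
  let ?f = "\<lambda>x::'a. (x, 0::'a)" and ?g = "\<lambda>x::'a. (0::'a, x)"
  have lin: "linear ?f" "linear ?g" by (auto intro!: linearI)
  have "(x, y) \<in> span (?f ` B \<union> ?g ` B)" for x y
  proof -
    have "?f x \<in> span (?f ` B)" "?g y \<in> span (?g ` B)"
      using B by (auto simp: linear_span_image[OF lin(1)] linear_span_image[OF lin(2)])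
    then have "?f x \<in> span (?f ` B \<union> ?g ` B)" "?g y \<in> span (?f ` B \<union> ?g ` B)"
      by (meson span_mono subsetD sup_ge1 sup_ge2)+
    from span_add[OF this] show ?thesis by simp
  qed
  then have "span (?f ` B \<union> ?g ` B) = UNIV" by auto
  then have fin: "\<exists>C::('a \<times> 'a) set. finite C \<and> span C = UNIV"
    using B(1) by (intro exI[of _ "?f ` B \<union> ?g ` B"]) auto
  have alt: "hat_bracket br z z = 0" for z
    using assms lie_algebra_antisym[OF assms, of "fst z" "snd z"]
    by (simp add: hat_bracket_def lie_algebra_def zero_prod_def)
  have J: "hat_bracket br z (hat_bracket br w v) + hat_bracket br w (hat_bracket br v z) +
           hat_bracket br v (hat_bracket br z w) = 0" for z w v
  proof -
    let ?S = "\<lambda>x y z. br x (br y z) + br y (br z x) + br z (br x y)"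
    obtain a a' c c' d d' where [simp]: "z = (a, a')" "w = (c, c')" "v = (d, d')"
      by (metis surj_pair)
    have "hat_bracket br z (hat_bracket br w v) + hat_bracket br w (hat_bracket br v z) +
           hat_bracket br v (hat_bracket br z w) =
      (?S a c d - ?S a c' d' - ?S a' c d' - ?S a' c' d,
       ?S a' c d + ?S a c' d + ?S a c d' - ?S a' c' d')"
      by (simp add: hat_bracket_def bilinear_radd[OF b] bilinear_rsub[OF b])
    then show ?thesis by (simp add: jac zero_prod_def)
  qed
  show ?thesis
    unfolding lie_algebra_def by (intro conjI allI fin bilinear_hat[OF b] alt J)
qed

text \<open>
  \<open>complexification_End H\<close> is a copy of the abstract complexification of \<open>H\<close>: the pair \<open>(A, B)\<close>
  is determined by \<open>A + i B\<close>.
\<close>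

lemma complexification_End_inj:
  assumes "linear A" "linear B" "linear A'" "linear B'"
    and "(\<lambda>z. cmplx_map A z + mult_i (cmplx_map B z)) = (\<lambda>z. cmplx_map A' z + mult_i (cmplx_map B' z))"
  shows "A = A' \<and> B = B'"
proof -
  have "A x = A' x \<and> B x = B' x" for x
    using fun_cong[OF assms(5), of "(x, 0)"] assms(1-4)
    by (simp add: cmplx_map_def mult_i_def linear_0)
  then show ?thesis by (simp add: fun_eq_iff)
qed

text \<open>
  Uniqueness of both connections: the difference of two torsion-free connections is symmetric, and
  it commutes with two anticommuting invertible endomorphisms.
\<close>

lemma torsion_free_unique:
  assumes "torsion_free br n1" "torsion_free br n2"
    and lA: "linear A" and lB: "linear B"
    and A: "\<And>x. A x = 0 \<Longrightarrow> x = 0" and B: "\<And>x. B x = 0 \<Longrightarrow> x = 0"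
    and AB: "\<And>x. A (B x) = - B (A x)"
    and p: "parallel n1 A" "parallel n2 A" "parallel n1 B" "parallel n2 B"
  shows "n1 = n2"
proof (intro ext)
  fix x y
  define S where "S = (\<lambda>x y. n1 x y - n2 x y)"
  have sym: "S x y = S y x" for x y
  proof -
    have "n1 x y - n1 y x - br x y = n2 x y - n2 y x - br x y"
      using assms(1,2) by (simp add: torsion_free_def)
    then show ?thesis by (simp add: S_def algebra_simps)
  qed
  have SA: "S x (A y) = A (S x y)" and SB: "S x (B y) = B (S x y)" for x y
    using p by (simp_all add: parallel_def S_def linear_diff[OF lA] linear_diff[OF lB])
  have "S (A x) (B y) = B (A (S x y))" using SA SB sym by metis
  moreover have "S (A x) (B y) = A (B (S x y))" using SA SB sym by metis
  ultimately have "B (A (S x y)) = - B (A (S x y))" by (simp add: AB)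
  then have "(2::real) *\<^sub>R B (A (S x y)) = 0"
    by (metis add.right_inverse scaleR_2)
  then have "B (A (S x y)) = 0" by simp
  then have "S x y = 0" using A B by blast
  then show "n1 x y = n2 x y" by (simp add: S_def)
qed

lemma cp_connection_exists:
  assumes "lie_algebra br" "complex_product_structure br J E"
  shows "\<exists>nab. is_cp_connection br J E nab"
proof -
  have b: "bilinear br" using assms by (simp add: lie_algebra_def)
  have lJ: "linear J" and JJ [simp]: "\<And>x. J (J x) = - x"
    and int: "\<And>x y. br x y + J (br (J x) y + br x (J y)) - br (J x) (J y) = 0"
    and lE: "linear E" and EE [simp]: "\<And>x. E (E x) = x" and JE: "\<And>x. J (E x) = - E (J x)"
    and sp: "\<And>x y. E x = x \<Longrightarrow> E y = y \<Longrightarrow> E (br x y) = br x y"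
    and sm: "\<And>x y. E x = - x \<Longrightarrow> E y = - y \<Longrightarrow> E (br x y) = - br x y"
    using assms
    by (auto simp: complex_product_structure_def complex_structure_def integrable_structure_def
        lie_subalgebra_def eigenspace_plus_def eigenspace_minus_def)
  define P Q where "P = proj_plus E" and "Q = proj_minus E"
  have lP: "linear P" and lQ: "linear Q"
    using linear_add[OF lE] linear_scale[OF lE]
    by (auto intro!: linearI simp: P_def Q_def proj_plus_def proj_minus_def algebra_simps)
  note lin = linear_add[OF lJ] linear_add[OF lE] linear_add[OF lP] linear_add[OF lQ]
    linear_scale[OF lJ] linear_scale[OF lE] linear_scale[OF lP] linear_scale[OF lQ]
    linear_neg[OF lJ] linear_neg[OF lE] linear_neg[OF lP] linear_neg[OF lQ]
    linear_diff[OF lJ] linear_diff[OF lE] linear_diff[OF lP] linear_diff[OF lQ]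
  note bil = bilinear_ladd[OF b] bilinear_radd[OF b] bilinear_lmul[OF b] bilinear_rmul[OF b]
    bilinear_lneg[OF b] bilinear_rneg[OF b]
  have PQ: "P x + Q x = x" for x by (simp add: P_def Q_def proj_plus_add_proj_minus)
  have EP [simp]: "E (P x) = P x" and EQ [simp]: "E (Q x) = - Q x" for x
    using proj_mem[OF lE EE] by (simp_all add: P_def Q_def)
  have P1: "P x = x" and Q1: "Q x = 0" if "E x = x" for x
    using that by (simp_all add: P_def Q_def proj_plus_def proj_minus_def half_half)
  have P2: "P x = 0" and Q2: "Q x = x" if "E x = - x" for x
    using that by (simp_all add: P_def Q_def proj_plus_def proj_minus_def half_half)
  have pp [simp]: "P (P x) = P x" "Q (P x) = 0" "P (Q x) = 0" "Q (Q x) = Q x" for x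
    by (simp_all add: P1 P2 Q1 Q2)
  have PJ [simp]: "P (J x) = J (Q x)" and QJ [simp]: "Q (J x) = J (P x)" for x
    by (simp_all add: P_def Q_def proj_plus_def proj_minus_def lin JE)
  have PE [simp]: "P (E x) = P x" "Q (E x) = - Q x" for x
    by (simp_all add: P_def Q_def proj_plus_def proj_minus_def add.commute
        flip: scaleR_minus_right)
  define nab where "nab x y =
    Q (br (P x) (Q y)) + P (br (Q x) (P y)) - J (Q (br (P x) (J (P y)))) - J (P (br (Q x) (J (Q y))))"
    for x y
  have EJ: "E (J x) = - J (E x)" for x by (simp add: JE)
  have anti: "br x y = - br y x" for x y using lie_algebra_antisym[OF assms(1)] .
  have 1: "left_invariant_connection nab"
    unfolding left_invariant_connection_def bilinear_def
    by (auto intro!: linearI simp: nab_def lin bil algebra_simps)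
  have 2: "parallel nab J"
    unfolding parallel_def by (simp add: nab_def lin bil algebra_simps)
  have 3: "parallel nab E"
    unfolding parallel_def by (simp add: nab_def lin bil EJ algebra_simps)
  have pl: "- J (Q (br x (J y))) + J (Q (br y (J x))) = br x y" if "E x = x" "E y = y" for x y
  proof -
    have "P (br x y + J (br (J x) y + br x (J y)) - br (J x) (J y)) = P 0" by (simp only: int)
    moreover have "E (J x) = - J x" "E (J y) = - J y" using that by (simp_all add: EJ)
    ultimately have "br x y + J (Q (br (J x) y)) + J (Q (br x (J y))) = 0"
      using that sp[of x y] sm[of "J x" "J y"]
      by (simp add: lin P1 P2 linear_0[OF lP] add.assoc)
    moreover have "Q (br (J x) y) = - Q (br y (J x))" by (simp add: anti[of "J x" y] lin)
    ultimately show ?thesis by (simp add: lin algebra_simps eq_neg_iff_add_eq_0)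
  qed
  have mi: "- J (P (br x (J y))) + J (P (br y (J x))) = br x y" if "E x = - x" "E y = - y" for x y
  proof -
    have "Q (br x y + J (br (J x) y + br x (J y)) - br (J x) (J y)) = Q 0" by (simp only: int)
    moreover have "E (J x) = J x" "E (J y) = J y" using that by (simp_all add: EJ lin)
    ultimately have "br x y + J (P (br (J x) y)) + J (P (br x (J y))) = 0"
      using that sm[of x y] sp[of "J x" "J y"]
      by (simp add: lin Q1 Q2 linear_0[OF lQ] add.assoc)
    moreover have "P (br (J x) y) = - P (br y (J x))" by (simp add: anti[of "J x" y] lin)
    ultimately show ?thesis by (simp add: lin algebra_simps eq_neg_iff_add_eq_0)
  qed
  have 4: "torsion_free br nab"
    unfolding torsion_free_def
  proof (intro allI)
    fix x y
    have "br x y = br (P x + Q x) (P y + Q y)" by (simp add: PQ)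
    also have "\<dots> = br (P x) (P y) + br (Q x) (Q y) + br (P x) (Q y) + br (Q x) (P y)"
      by (simp add: bil)
    also have "br (P x) (Q y) = Q (br (P x) (Q y)) - P (br (Q y) (P x))"
      using PQ[of "br (P x) (Q y)"] by (simp add: anti[of "Q y" "P x"] lin add.commute)
    also have "br (Q x) (P y) = P (br (Q x) (P y)) - Q (br (P y) (Q x))"
      using PQ[of "br (Q x) (P y)"] by (simp add: anti[of "P y" "Q x"] lin)
    also note pl[OF EP EP, of x y, symmetric]
    also note mi[OF EQ EQ, of x y, symmetric]
    finally show "nab x y - nab y x - br x y = 0"
      by (simp add: nab_def)
  qed
  show ?thesis using 1 2 3 4 unfolding is_cp_connection_def by blast
qed

lemma cp_connection_ex1:
  assumes "lie_algebra br" "complex_product_structure br J E"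
  shows "\<exists>!nab. is_cp_connection br J E nab"
proof (rule ex_ex1I[OF cp_connection_exists[OF assms]])
  fix n1 n2
  assume n: "is_cp_connection br J E n1" "is_cp_connection br J E n2"
  have lJ: "linear J" and JJ: "\<And>x. J (J x) = - x"
    and lE: "linear E" and EE: "\<And>x. E (E x) = x" and JE: "\<And>x. J (E x) = - E (J x)"
    using assms by (auto simp: complex_product_structure_def complex_structure_def)
  show "n1 = n2"
  proof (rule torsion_free_unique[OF _ _ lJ lE])
    show "x = 0" if "J x = 0" for x using JJ[of x] that linear_0[OF lJ] by simp
    show "x = 0" if "E x = 0" for x using EE[of x] that linear_0[OF lE] by simp
  qed (use n JE in \<open>auto simp: is_cp_connection_def\<close>)
qed

lemma obata_connection_exists:
  assumes "lie_algebra br" "complex_product_structure br J E"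
  shows "\<exists>nab. is_obata_connection (hat_bracket br) (hat_J1 J) (hat_J2 E) (hat_J3 J E) nab"
proof -
  have lJ: "linear J" and JJ: "\<And>x. J (J x) = - x"
    and lE: "linear E" and EE: "\<And>x. E (E x) = x" and JE: "\<And>x. J (E x) = - E (J x)"
    using assms by (auto simp: complex_product_structure_def complex_structure_def)
  have hJ1: "hat_J1 J (x, y) = (J x, J y)" for x y by (simp add: hat_J1_def)
  have hJ3: "hat_J3 J E (x, y) = (- J (E y), J (E x))" for x y
    by (simp add: hat_J3_def hJ1 hat_J2_eq linear_neg[OF lJ])
  obtain n where n: "is_cp_connection br J E n"
    using cp_connection_exists[OF assms] by blast
  then have b: "bilinear n" and t: "\<And>x y. n x y - n y x = br x y"
    and nJ: "\<And>x y. n x (J y) = J (n x y)" and nE: "\<And>x y. n x (E y) = E (n x y)"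
    by (auto simp: is_cp_connection_def left_invariant_connection_def torsion_free_def parallel_def)
  have "torsion_free (hat_bracket br) (hat_bracket n)"
    by (auto simp: torsion_free_def hat_bracket_def zero_prod_def simp flip: t)
  moreover have "parallel (hat_bracket n) (hat_J1 J)"
    by (auto simp: parallel_def hat_bracket_def zero_prod_def hJ1 nJ
        linear_add[OF lJ] linear_diff[OF lJ])
  moreover have "parallel (hat_bracket n) (hat_J2 E)"
    by (auto simp: parallel_def hat_bracket_def zero_prod_def hat_J2_eq nE
        linear_add[OF lE] linear_diff[OF lE] bilinear_rneg[OF b])
  moreover have "parallel (hat_bracket n) (hat_J3 J E)"
    by (auto simp: parallel_def hat_bracket_def zero_prod_def hJ3 nE nJ linear_neg[OF lJ]
        linear_add[OF lE] linear_diff[OF lE] linear_add[OF lJ] linear_diff[OF lJ]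
        bilinear_rneg[OF b])
  ultimately show ?thesis
    using bilinear_hat[OF b] unfolding is_obata_connection_def left_invariant_connection_def by blast
qed

lemma parallel_integrable:
  assumes "linear J" "\<And>x. J (J x) = - x" "torsion_free br nab" "parallel nab J"
  shows "integrable_structure br J"
proof -
  have br: "br x y = nab x y - nab y x" for x y
    using assms(3) unfolding torsion_free_def by (metis eq_iff_diff_eq_0)
  have p: "nab x (J y) = J (nab x y)" for x y
    using assms(4) unfolding parallel_def by (metis eq_iff_diff_eq_0)
  show ?thesis
    by (simp add: integrable_structure_def br p assms(2) linear_add[OF assms(1)]
        linear_diff[OF assms(1)])
qed

lemma hypercomplex_hat:
  assumes "lie_algebra br" "complex_product_structure br J E"
  shows "hypercomplex_structure (hat_bracket br) (hat_J1 J) (hat_J2 E) (hat_J3 J E)"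
proof -
  have lJ: "linear J" and JJ: "\<And>x. J (J x) = - x"
    and lE: "linear E" and EE: "\<And>x. E (E x) = x" and JE: "\<And>x. J (E x) = - E (J x)"
    using assms by (auto simp: complex_product_structure_def complex_structure_def)
  note lin = linear_add[OF lJ] linear_add[OF lE] linear_scale[OF lJ] linear_scale[OF lE]
    linear_neg[OF lJ] linear_neg[OF lE]
  have hJ1: "hat_J1 J (x, y) = (J x, J y)" for x y by (simp add: hat_J1_def)
  have hJ3: "hat_J3 J E (x, y) = (- J (E y), J (E x))" for x y
    by (simp add: hat_J3_def hJ1 hat_J2_eq lin)
  have l: "linear (hat_J1 J)" "linear (hat_J2 E)" "linear (hat_J3 J E)"
    by (auto intro!: linearI simp: hJ1 hJ3 hat_J2_eq lin)
  have s: "hat_J1 J (hat_J1 J z) = - z" "hat_J2 E (hat_J2 E z) = - z"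
    "hat_J3 J E (hat_J3 J E z) = - z" "hat_J1 J (hat_J2 E z) = - hat_J2 E (hat_J1 J z)" for z
    by (cases z, simp add: hJ1 hJ3 hat_J2_eq lin JJ EE JE)+
  obtain n where "is_obata_connection (hat_bracket br) (hat_J1 J) (hat_J2 E) (hat_J3 J E) n"
    using obata_connection_exists[OF assms] by blast
  then have n: "torsion_free (hat_bracket br) n"
    "parallel n (hat_J1 J)" "parallel n (hat_J2 E)" "parallel n (hat_J3 J E)"
    by (simp_all add: is_obata_connection_def)
  have i: "integrable_structure (hat_bracket br) (hat_J1 J)"
    "integrable_structure (hat_bracket br) (hat_J2 E)"
    "integrable_structure (hat_bracket br) (hat_J3 J E)"
    by (fact parallel_integrable[OF l(1) s(1) n(1,2)] parallel_integrable[OF l(2) s(2) n(1,3)]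
        parallel_integrable[OF l(3) s(3) n(1,4)])+
  have "hat_J3 J E z = hat_J1 J (hat_J2 E z)" for z by (simp add: hat_J3_def)
  then show ?thesis
    unfolding hypercomplex_structure_def complex_structure_def
    using l i s by blast
qed

lemma obata_connection_ex1:
  assumes "lie_algebra br" "complex_product_structure br J E"
  shows "\<exists>!nab. is_obata_connection (hat_bracket br) (hat_J1 J) (hat_J2 E) (hat_J3 J E) nab"
proof (rule ex_ex1I[OF obata_connection_exists[OF assms]])
  fix n1 n2
  let ?ob = "is_obata_connection (hat_bracket br) (hat_J1 J) (hat_J2 E) (hat_J3 J E)"
  assume n: "?ob n1" "?ob n2"
  note h = hypercomplex_hat[OF assms]
  have l: "linear (hat_J1 J)" "linear (hat_J2 E)"
    and s: "\<And>x. hat_J1 J (hat_J1 J x) = - x" "\<And>x. hat_J2 E (hat_J2 E x) = - x"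
    and a: "\<And>x. hat_J1 J (hat_J2 E x) = - hat_J2 E (hat_J1 J x)"
    using h unfolding hypercomplex_structure_def complex_structure_def by blast+
  show "n1 = n2"
  proof (rule torsion_free_unique[OF _ _ l])
    show "x = 0" if "hat_J1 J x = 0" for x using s(1)[of x] that linear_0[OF l(1)] by simp
    show "x = 0" if "hat_J2 E x = 0" for x using s(2)[of x] that linear_0[OF l(2)] by simp
  qed (use n a in \<open>auto simp: is_obata_connection_def\<close>)
qed

end

theory Submission
  imports Defs
begin

text \<open>
  By uniqueness the Obata connection is the complex bilinear extension of \<open>\<nabla>\<^sup>C\<^sup>P\<close>, so its curvature
  is the complex bilinear extension of the curvature of \<open>\<nabla>\<^sup>C\<^sup>P\<close>.  Hence the complexified holonomy
  algebra contains the curvature of the extension and has the required closure properties.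
  Conversely, given any \<open>S\<close> competing in the definition of the holonomy algebra of the extension,
  the endomorphisms \<open>A\<close> for which both \<open>A\<close> and \<open>i A\<close> lie in \<open>S\<close> compete in the definition of
  \<open>hol\<^sup>C\<^sup>P\<close>; here \<open>i R(x, y) = R(i x, y)\<close> and \<open>i [A, B] = [i A, B]\<close>.
\<close>

text \<open>This is A + iB in the form used by \<open>complexification_End\<close>. Naming it lets
  sums, real multiples and commutators be computed on the pair (A, B).\<close>

definition complex_comb ::
  "('a::real_vector \<Rightarrow> 'a) \<Rightarrow> ('a \<Rightarrow> 'a) \<Rightarrow> 'a \<times> 'a \<Rightarrow> 'a \<times> 'a" where
  "complex_comb A B = (\<lambda>z. cmplx_map A z + mult_i (cmplx_map B z))"

lemma complexification_End_eq: "complexification_End H = {complex_comb A B |A B. A \<in> H \<and> B \<in> H}"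
  by (auto simp: complexification_End_def complex_comb_def)

lemma complex_comb_apply: "complex_comb A B z = (A (fst z) - B (snd z), A (snd z) + B (fst z))"
  by (simp add: complex_comb_def cmplx_map_def mult_i_def)

lemma linear_complex_comb:
  assumes "linear A" "linear B"
  shows "linear (complex_comb A B)"
  by (rule linearI)
    (simp_all add: complex_comb_apply assms linear_add linear_scale algebra_simps)

lemma complex_comb_zero: "complex_comb (\<lambda>x. 0) (\<lambda>x. 0) = (\<lambda>z. 0)"
  by (auto simp: complex_comb_apply zero_prod_def)

lemma complex_comb_add:
  "(\<lambda>z. complex_comb A B z + complex_comb A' B' z) =
   complex_comb (\<lambda>x. A x + A' x) (\<lambda>x. B x + B' x)"
  by (auto simp: complex_comb_apply)

lemma complex_comb_scale:
  "(\<lambda>z. c *\<^sub>R complex_comb A B z) = complex_comb (\<lambda>x. c *\<^sub>R A x) (\<lambda>x. c *\<^sub>R B x)"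
  by (auto simp: complex_comb_apply algebra_simps)

text \<open>The factor i commutes with every complexified real linear map and i^2 = -1, so the
  commutator expands as a complex bilinear product.\<close>

lemma complex_comb_commutator:
  assumes "linear A" "linear B" "linear A'" "linear B'"
  shows "End_commutator (complex_comb A B) (complex_comb A' B') =
    complex_comb (\<lambda>x. End_commutator A A' x - End_commutator B B' x)
      (\<lambda>x. End_commutator A B' x + End_commutator B A' x)"
  by (auto simp: complex_comb_apply End_commutator_def assms linear_add linear_diff)

text \<open>Applied to a connection, this puts the endomorphism nabla_z in the form A + iB, so that
  \<open>complex_comb_commutator\<close> also covers commutators with it.\<close>

lemma hat_bracket_eq_complex_comb:
  "hat_bracket b z = complex_comb (b (fst z)) (b (snd z))"
  by (auto simp: hat_bracket_def complex_comb_apply)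

text \<open>Each of the three curvature terms is complex trilinear for the extended maps. The two
  parts are those of the product of x + ix' and y + iy'.\<close>

lemma curvature_hat:
  assumes "bilinear br" "bilinear nab"
  shows "curvature (hat_bracket br) (hat_bracket nab) z w =
    complex_comb
      (\<lambda>v. curvature br nab (fst z) (fst w) v - curvature br nab (snd z) (snd w) v)
      (\<lambda>v. curvature br nab (fst z) (snd w) v + curvature br nab (snd z) (fst w) v)"
  by (auto simp: curvature_def hat_bracket_def complex_comb_apply assms
      bilinear_ladd bilinear_radd bilinear_lsub bilinear_rsub)

lemma lie_subalgebra_EndD:
  assumes "lie_subalgebra_End S"
  shows "A \<in> S \<Longrightarrow> linear A"
    and "(\<lambda>x. 0) \<in> S"
    and "A \<in> S \<Longrightarrow> B \<in> S \<Longrightarrow> (\<lambda>x. A x + B x) \<in> S"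
    and "A \<in> S \<Longrightarrow> (\<lambda>x. c *\<^sub>R A x) \<in> S"
    and "A \<in> S \<Longrightarrow> B \<in> S \<Longrightarrow> End_commutator A B \<in> S"
  using assms unfolding lie_subalgebra_End_def by blast+

lemma lie_subalgebra_End_diff:
  assumes "lie_subalgebra_End S" "A \<in> S" "B \<in> S"
  shows "(\<lambda>x. A x - B x) \<in> S"
  using lie_subalgebra_EndD(3)[OF assms(1,2) lie_subalgebra_EndD(4)[OF assms(1,3), of "-1"]]
  by simp

lemma linear_End_commutator:
  assumes "linear A" "linear B"
  shows "linear (End_commutator A B)"
  by (rule linearI)
    (simp_all add: End_commutator_def assms linear_add linear_scale algebra_simps)

lemma linear_bilinear: "bilinear b \<Longrightarrow> linear (b x)"
  by (simp add: bilinear_def)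

lemma linear_curvature:
  assumes "bilinear nab"
  shows "linear (curvature br nab x y)"
  by (rule linearI)
    (simp_all add: curvature_def bilinear_radd[OF assms] bilinear_rmul[OF assms] algebra_simps)

lemma lie_subalgebra_End_linear: "lie_subalgebra_End {A. linear A}"
  by (auto simp: lie_subalgebra_End_def linear_End_commutator linear_compose_add
      linear_compose_scale_right intro: linearI)

text \<open>The closure conditions pass to any intersection, but linearity of the members requires a
  nonempty family. The algebra of all linear maps is a competitor.\<close>

lemma lie_subalgebra_End_holonomy:
  assumes "bilinear nab"
  shows "lie_subalgebra_End (holonomy_algebra br nab)"
proof -
  have "holonomy_algebra br nab \<subseteq> {A. linear A}"
    unfolding holonomy_algebra_def
    using lie_subalgebra_End_linear linear_curvature[OF assms] linear_bilinear[OF assms]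
      linear_End_commutator
    by (intro Inter_lower) blast
  then show ?thesis
    unfolding lie_subalgebra_End_def[of "holonomy_algebra br nab"]
    by (auto simp: holonomy_algebra_def dest: lie_subalgebra_EndD)
qed

lemma curvature_in_holonomy: "curvature br nab x y \<in> holonomy_algebra br nab"
  by (auto simp: holonomy_algebra_def)

lemma commutator_in_holonomy:
  "A \<in> holonomy_algebra br nab \<Longrightarrow> End_commutator (nab u) A \<in> holonomy_algebra br nab"
  by (auto simp: holonomy_algebra_def)

lemma holonomy_algebra_subset:
  assumes "lie_subalgebra_End S"
    and "\<And>x y. curvature br nab x y \<in> S"
    and "\<And>u A. A \<in> S \<Longrightarrow> End_commutator (nab u) A \<in> S"
  shows "holonomy_algebra br nab \<subseteq> S"
  unfolding holonomy_algebra_def using assms by (intro Inter_lower) blast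

lemma complex_comb_in_complexification:
  "A \<in> H \<Longrightarrow> B \<in> H \<Longrightarrow> complex_comb A B \<in> complexification_End H"
  by (auto simp: complexification_End_eq)

lemma lie_subalgebra_End_complexification:
  assumes H: "lie_subalgebra_End H"
  shows "lie_subalgebra_End (complexification_End H)"
  unfolding lie_subalgebra_End_def
proof (intro conjI ballI allI)
  note D = lie_subalgebra_EndD[OF H]
  note C = complex_comb_in_complexification
  show "(\<lambda>z. 0) \<in> complexification_End H"
    using C[OF D(2) D(2)] by (simp add: complex_comb_zero)
  fix X assume "X \<in> complexification_End H"
  then obtain A B where X: "X = complex_comb A B" "A \<in> H" "B \<in> H"
    by (auto simp: complexification_End_eq)
  show "linear X"
    using X D(1) linear_complex_comb by blast
  show "(\<lambda>z. c *\<^sub>R X z) \<in> complexification_End H" for c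
    unfolding X(1) complex_comb_scale by (intro C D(4) X)
  fix Y assume "Y \<in> complexification_End H"
  then obtain A' B' where Y: "Y = complex_comb A' B'" "A' \<in> H" "B' \<in> H"
    by (auto simp: complexification_End_eq)
  show "(\<lambda>z. X z + Y z) \<in> complexification_End H"
    unfolding X(1) Y(1) complex_comb_add by (intro C D(3) X Y)
  show "End_commutator X Y \<in> complexification_End H"
    unfolding X(1) Y(1) complex_comb_commutator[OF D(1)[OF X(2)] D(1)[OF X(3)] D(1)[OF Y(2)] D(1)[OF Y(3)]]
    by (intro C D(3,5) lie_subalgebra_End_diff[OF H] X Y)
qed

text \<open>The comparison is made for a connection and its complex bilinear extension; J and E
  enter only afterwards, in recognising the Obata connection as such an extension.\<close>

theorem holonomy_algebra_hat:
  assumes br: "bilinear br" and nab: "bilinear nab"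
  shows "holonomy_algebra (hat_bracket br) (hat_bracket nab) =
    complexification_End (holonomy_algebra br nab)"
proof
  let ?H = "holonomy_algebra br nab"
  have H: "lie_subalgebra_End ?H"
    using lie_subalgebra_End_holonomy[OF nab] .
  note D = lie_subalgebra_EndD[OF H]
  show "holonomy_algebra (hat_bracket br) (hat_bracket nab) \<subseteq> complexification_End ?H"
  proof (rule holonomy_algebra_subset[OF lie_subalgebra_End_complexification[OF H]])
    show "curvature (hat_bracket br) (hat_bracket nab) z w \<in> complexification_End ?H" for z w
      unfolding curvature_hat[OF br nab]
      by (intro complex_comb_in_complexification D(3) lie_subalgebra_End_diff[OF H]
          curvature_in_holonomy)
    fix u X assume "X \<in> complexification_End ?H"
    then obtain A B where X: "X = complex_comb A B" "A \<in> ?H" "B \<in> ?H"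
      by (auto simp: complexification_End_eq)
    \<comment> \<open>For u = a + ib both components are sums or differences of commutators of
      nabla_a or nabla_b with A or B, all of which lie in \<open>?H\<close>.\<close>
    show "End_commutator (hat_bracket nab u) X \<in> complexification_End ?H"
      unfolding X(1) hat_bracket_eq_complex_comb[of nab u]
        complex_comb_commutator[OF linear_bilinear[OF nab] linear_bilinear[OF nab]
          D(1)[OF X(2)] D(1)[OF X(3)]]
      by (intro complex_comb_in_complexification D(3) lie_subalgebra_End_diff[OF H]
          commutator_in_holonomy X)
  qed
next
  let ?z = "\<lambda>x::'a. 0::'a"
  have lz: "linear ?z" by (rule linearI) simp_all
  have "complexification_End (holonomy_algebra br nab) \<subseteq> S"
    if S: "lie_subalgebra_End S"
      and R: "\<And>z w. curvature (hat_bracket br) (hat_bracket nab) z w \<in> S"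
      and N: "\<And>u X. X \<in> S \<Longrightarrow> End_commutator (hat_bracket nab u) X \<in> S" for S
  proof -
    note D = lie_subalgebra_EndD[OF S]
    \<comment> \<open>\<open>S\<close> is only a real Lie algebra and may fail to be closed under
      multiplication by i, so iA is required separately.\<close>
    define T where "T = {A. linear A \<and> complex_comb A ?z \<in> S \<and> complex_comb ?z A \<in> S}"
    \<comment> \<open>Below, curvature and connection are evaluated at purely real or purely
      imaginary vectors; these facts remove the terms coming from the zero components.\<close>
    have R0: "curvature br nab 0 y = ?z" "curvature br nab x 0 = ?z" for x y
      by (auto simp: curvature_def bilinear_lzero[OF br] bilinear_rzero[OF br]
          bilinear_lzero[OF nab] bilinear_rzero[OF nab])
    have c0: "End_commutator A ?z = ?z" "End_commutator ?z A = ?z" if "linear A" for A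
      by (auto simp: End_commutator_def linear_0[OF that])
    have n0: "nab 0 = ?z"
      by (auto simp: bilinear_lzero[OF nab])
    have "holonomy_algebra br nab \<subseteq> T"
    proof (rule holonomy_algebra_subset)
      show "lie_subalgebra_End T"
        unfolding lie_subalgebra_End_def
      proof (intro conjI ballI allI)
        show "?z \<in> T"
          using D(2) by (simp add: T_def lz complex_comb_zero)
        fix A assume A: "A \<in> T"
        then show "linear A" by (simp add: T_def)
        show "(\<lambda>x. c *\<^sub>R A x) \<in> T" for c
          using A D(4)[of "complex_comb A ?z" c] D(4)[of "complex_comb ?z A" c]
          by (simp add: T_def complex_comb_scale linear_compose_scale_right)
        fix B assume B: "B \<in> T"
        show "(\<lambda>x. A x + B x) \<in> T"
          using A B D(3)[of "complex_comb A ?z" "complex_comb B ?z"]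
            D(3)[of "complex_comb ?z A" "complex_comb ?z B"]
          by (simp add: T_def complex_comb_add linear_compose_add)
        show "End_commutator A B \<in> T"
          using A B D(5)[of "complex_comb A ?z" "complex_comb B ?z"]
            D(5)[of "complex_comb ?z A" "complex_comb B ?z"]
          by (simp add: T_def complex_comb_commutator lz c0 linear_End_commutator)
      qed
      \<comment> \<open>The pair (0, x) stands for ix, so the second instance yields i R(x,
        y).\<close>
      show "curvature br nab x y \<in> T" for x y
        using R[of "(x, 0)" "(y, 0)"] R[of "(0, x)" "(y, 0)"]
        by (simp add: T_def curvature_hat[OF br nab] R0 linear_curvature[OF nab])
      \<comment> \<open>Real directions suffice: nabla_u extends complex linearly, so its commutator
        with iA is i times its commutator with A.\<close>
      show "End_commutator (nab u) A \<in> T" if "A \<in> T" for u A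
        using that N[of "complex_comb A ?z" "(u, 0)"] N[of "complex_comb ?z A" "(u, 0)"]
        by (simp add: T_def hat_bracket_eq_complex_comb n0 complex_comb_commutator lz c0
            linear_bilinear[OF nab] linear_End_commutator)
    qed
    moreover have "complex_comb A B \<in> S" if "A \<in> T" "B \<in> T" for A B
      using that D(3)[of "complex_comb A ?z" "complex_comb ?z B"]
      by (simp add: T_def complex_comb_add)
    ultimately show ?thesis
      by (auto simp: complexification_End_eq)
  qed
  then show "complexification_End (holonomy_algebra br nab) \<subseteq>
      holonomy_algebra (hat_bracket br) (hat_bracket nab)"
    unfolding holonomy_algebra_def[of "hat_bracket br"] by (intro Inter_greatest) blast
qed

text \<open>Beyond existence, this provides the explicit witness that uniqueness then identifies
  with the Obata connection. \<open>hat_J2 E\<close> is i times the complexification of E, so it is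
  parallel because E is.\<close>

lemma is_obata_connection_hat:
  assumes "complex_product_structure br J E" "is_cp_connection br J E n"
  shows "is_obata_connection (hat_bracket br) (hat_J1 J) (hat_J2 E) (hat_J3 J E) (hat_bracket n)"
proof -
  have lJ: "linear J" and lE: "linear E"
    using assms(1) by (auto simp: complex_product_structure_def complex_structure_def)
  have b: "bilinear n" and t: "\<And>x y. n x y - n y x = br x y"
    and nJ: "\<And>x y. n x (J y) = J (n x y)" and nE: "\<And>x y. n x (E y) = E (n x y)"
    using assms(2)
    by (auto simp: is_cp_connection_def left_invariant_connection_def torsion_free_def parallel_def)
  have "torsion_free (hat_bracket br) (hat_bracket n)"
    by (auto simp: torsion_free_def hat_bracket_def zero_prod_def simp flip: t)
  moreover have J1: "parallel (hat_bracket n) (hat_J1 J)"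
    by (auto simp: parallel_def hat_bracket_def zero_prod_def hat_J1_def nJ
        linear_add[OF lJ] linear_diff[OF lJ])
  moreover have J2: "parallel (hat_bracket n) (hat_J2 E)"
    by (auto simp: parallel_def hat_bracket_def zero_prod_def hat_J2_eq nE
        linear_add[OF lE] linear_diff[OF lE] bilinear_rneg[OF b])
  \<comment> \<open>A composition of parallel endomorphisms is parallel.\<close>
  moreover have "parallel (hat_bracket n) (hat_J3 J E)"
    using J1 J2 unfolding parallel_def hat_J3_def comp_apply eq_iff_diff_eq_0[symmetric] by metis
  ultimately show ?thesis
    using bilinear_hat[OF b] by (simp add: is_obata_connection_def left_invariant_connection_def)
qed

theorem proposition2p7:
  fixes br :: "'a::real_vector \<Rightarrow> 'a \<Rightarrow> 'a" and J E :: "'a \<Rightarrow> 'a"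
  assumes "lie_algebra br"
    and "complex_product_structure br J E"
  shows "holonomy_algebra (hat_bracket br)
           (obata_connection (hat_bracket br) (hat_J1 J) (hat_J2 E) (hat_J3 J E)) =
         complexification_End (holonomy_algebra br (cp_connection br J E))"
proof -
  let ?n = "cp_connection br J E"
  have n: "is_cp_connection br J E ?n"
    unfolding cp_connection_def by (rule theI'[OF cp_connection_ex1[OF assms]])
  let ?ob = "is_obata_connection (hat_bracket br) (hat_J1 J) (hat_J2 E) (hat_J3 J E)"
  have "?ob (hat_bracket ?n)"
    by (rule is_obata_connection_hat[OF assms(2) n])
  moreover have "\<exists>!nab. ?ob nab"
    by (rule obata_connection_ex1[OF assms])
  ultimately have "obata_connection (hat_bracket br) (hat_J1 J) (hat_J2 E) (hat_J3 J E) = hat_bracket ?n"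
    unfolding obata_connection_def using the1_equality[of ?ob "hat_bracket ?n"] by blast
  moreover have "bilinear br" "bilinear ?n"
    using assms(1) n
    by (auto simp: lie_algebra_def is_cp_connection_def left_invariant_connection_def)
  ultimately show ?thesis by (simp add: holonomy_algebra_hat)
qed

end
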